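(* Let $n$ be a positive integer and let $A\subseteq B$ be an extension of commutative rings. If $A+XB[X]$ is an $n$-OAF-ring, then $A$ is a finite direct product of fields.
   Context: All rings are commutative with $1\neq 0$. For a ring extension $A\subseteq B$, $A+XB[X]$ is the subring of $B[X]$ consisting of the polynomials whose constant term lies in $A$. A proper ideal $I$ of a ring $R$ is an $n$-OA ideal if whenever $a_1a_2\cdots a_{n+1}\in I$ for nonunits $a_1,\ldots,a_{n+1}\in R$, then $a_1a_2\cdots a_n\in I$ or $a_{n+1}\in I$. A ring $R$ is an $n$-OAF-ring if every proper ideal of $R$ is a product of finitely many $n$-OA ideals of $R$. *)

theory Defs
  imports "HOL-Algebra.UnivPoly" "HOL-Algebra.Chinese_Remainder" "HOL-Algebra.Subrings"
begin

text \<open>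
  The ring \<open>A + X B[X]\<close>, for a ring \<open>B\<close> and the carrier \<open>A\<close> of a subring of \<open>B\<close>.
\<close>
definition const_in_poly_ring :: "'a set \<Rightarrow> ('a, 'm) ring_scheme \<Rightarrow> ('a, nat \<Rightarrow> 'a) up_ring"
  where "const_in_poly_ring A B =
    (UP B)\<lparr>carrier := {p \<in> carrier (UP B). coeff (UP B) p 0 \<in> A}\<rparr>"

definition n_OA_ideal :: "nat \<Rightarrow> 'a set \<Rightarrow> ('a, 'm) ring_scheme \<Rightarrow> bool"
  where "n_OA_ideal n I R \<longleftrightarrow>
    ideal I R \<and> I \<noteq> carrier R \<and>
    (\<forall>a :: nat \<Rightarrow> 'a.
      (\<forall>i\<in>{1..n+1}. a i \<in> carrier R - Units R) \<longrightarrow>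
      (\<Otimes>\<^bsub>R\<^esub>i\<in>{1..n+1}. a i) \<in> I \<longrightarrow>
      (\<Otimes>\<^bsub>R\<^esub>i\<in>{1..n}. a i) \<in> I \<or> a (n+1) \<in> I)"

text \<open>
  The empty product of ideals is \<open>carrier R\<close>, the unit for the multiplication of ideals. As it is
  not proper, it never serves as a factorization of a proper ideal.
\<close>
definition n_OAF_ring :: "nat \<Rightarrow> ('a, 'm) ring_scheme \<Rightarrow> bool"
  where "n_OAF_ring n R \<longleftrightarrow>
    (\<forall>I. ideal I R \<and> I \<noteq> carrier R \<longrightarrow>
      (\<exists>Js. (\<forall>J\<in>set Js. n_OA_ideal n J R) \<and> I = foldr (ideal_prod R) Js (carrier R)))"

text \<open>
  Every factor of a direct product decomposition of \<open>R\<close> is isomorphic to a quotient ring of \<open>R\<close>,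
  whose elements are cosets; so letting the factors range over rings on the type \<open>'a set\<close> is no
  restriction.
\<close>
definition finite_product_of_fields :: "('a, 'm) ring_scheme \<Rightarrow> bool"
  where "finite_product_of_fields R \<longleftrightarrow>
    (\<exists>Fs :: 'a set ring list. (\<forall>F\<in>set Fs. field F) \<and> R \<simeq> RDirProd_list Fs)"

lemma (in cring) subcring_const_in_poly_ring:
  assumes "subring A R"
  shows "subcring (carrier (const_in_poly_ring A R)) (UP R)"
proof -
  interpret UP_cring R "UP R"
    by unfold_locales
  show ?thesis
  proof (rule P.subcringI', rule P.subringI)
    show "carrier (const_in_poly_ring A R) \<subseteq> carrier (UP R)"
      by (auto simp: const_in_poly_ring_def)
    show "\<one>\<^bsub>UP R\<^esub> \<in> carrier (const_in_poly_ring A R)"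
      using subringE(3)[OF assms] by (simp add: const_in_poly_ring_def)
  next
    fix h assume h: "h \<in> carrier (const_in_poly_ring A R)"
    then show "\<ominus>\<^bsub>UP R\<^esub> h \<in> carrier (const_in_poly_ring A R)"
      using subringE(5)[OF assms] by (simp add: const_in_poly_ring_def)
  next
    fix p q assume "p \<in> carrier (const_in_poly_ring A R)" "q \<in> carrier (const_in_poly_ring A R)"
    then have *: "p \<in> carrier (UP R)" "q \<in> carrier (UP R)"
      "coeff (UP R) p 0 \<in> A" "coeff (UP R) q 0 \<in> A"
      by (auto simp: const_in_poly_ring_def)
    then show "p \<otimes>\<^bsub>UP R\<^esub> q \<in> carrier (const_in_poly_ring A R)"
      using subringE(6)[OF assms] coeff_closed by (simp add: const_in_poly_ring_def)
    show "p \<oplus>\<^bsub>UP R\<^esub> q \<in> carrier (const_in_poly_ring A R)"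
      using * subringE(7)[OF assms] by (simp add: const_in_poly_ring_def)
  qed
qed

end

theory Submission
  imports Defs
begin

text \<open>
  Write \<open>S = A + X B[X]\<close>. The nonunits \<open>X\<close> and \<open>1 - X\<close> of \<open>S\<close> add up to \<open>1\<close>. If \<open>I\<close> is n-OA
  and a product of nonunits \<open>a\<^sub>1\<close>, ..., \<open>a\<^sub>n\<close> lies in \<open>I\<close> while \<open>a\<^sub>n\<close> does not, then inserting a
  further nonunit \<open>e\<close> shows that \<open>e\<close> times the product of the first \<open>n - 1\<close> factors lies in \<open>I\<close>;
  adding up the cases \<open>e = X\<close> and \<open>e = 1 - X\<close> removes \<open>e\<close>. So \<open>I\<close> is already (n-1)-OA, and
  by descent it is prime (\<open>n_OA_ideal_imp_primeideal\<close>). Hence every proper ideal of \<open>S\<close> is a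
  product of prime ideals, that is, \<open>S\<close> is a general ZPI-ring.

  What follows uses only the coefficients of degree 0 and 1, where a product of polynomials obeys
  the Leibniz rule: the linear coefficient of \<open>p q\<close> is \<open>p\<^sub>0 q\<^sub>1 + p\<^sub>1 q\<^sub>0\<close>. As a consequence,
  products of ideals that contain \<open>X B[X]\<close> inherit closure properties of the factors.

  First, \<open>A = B\<close> (\<open>general_ZPI_ring_imp_eq_carrier\<close>). The ideal of all \<open>f\<close> with \<open>f\<^sub>0 = 0\<close> and
  \<open>f\<^sub>1 \<in> A\<close> is a product of primes. It contains the square of each element of \<open>X B[X]\<close>, so these
  primes all contain \<open>X B[X]\<close>, and they are therefore closed under multiplying the linear
  coefficient by an element \<open>b\<close> of \<open>B\<close>. By the Leibniz rule so is their product; applied to \<open>X\<close>,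
  this gives \<open>b \<in> A\<close>.

  Now let \<open>A = B\<close>, let \<open>J\<close> be a proper ideal of \<open>A\<close>, and write \<open>J + X A[X]\<close> as a product of primes.
  If \<open>a \<in> A\<close> lies in all of these primes, then by the Leibniz rule \<open>a f\<^sub>1\<close> lies in the product
  whenever \<open>f\<close> does. Since \<open>X\<close> is in the product, so is \<open>a\<close>. Hence \<open>J\<close> is the
  intersection of finitely many primes of \<open>A\<close> (\<open>const_coeff_ideal_factorization\<close>). For
  \<open>J = a\<^sup>2 A\<close> this yields \<open>a \<in> a\<^sup>2 A\<close>, so \<open>A\<close> is von Neumann regular and its primes are maximal. For
  \<open>J = 0\<close> it yields finitely many maximal ideals with intersection zero, and the Chinese
  remainder theorem finishes the proof.
\<close>

section \<open>Products of prime ideals\<close>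

definition general_ZPI_ring :: "('a, 'm) ring_scheme \<Rightarrow> bool"
  where "general_ZPI_ring R \<longleftrightarrow>
    (\<forall>I. ideal I R \<and> I \<noteq> carrier R \<longrightarrow>
      (\<exists>Ps. (\<forall>P\<in>set Ps. primeideal P R) \<and> I = foldr (ideal_prod R) Ps (carrier R)))"

lemma general_ZPI_ringE:
  assumes "general_ZPI_ring R" "ideal I R" "I \<noteq> carrier R"
  obtains Ps where "\<And>P. P \<in> set Ps \<Longrightarrow> primeideal P R"
    and "I = foldr (ideal_prod R) Ps (carrier R)"
  using assms unfolding general_ZPI_ring_def by blast

lemma (in ring) ideal_foldr_ideal_prod:
  assumes "\<And>J. J \<in> set Js \<Longrightarrow> ideal J R"
  shows "ideal (foldr (ideal_prod R) Js (carrier R)) R"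
  using assms by (induction Js) (auto simp: oneideal intro: ideal_prod_is_ideal)

lemma (in ring) foldr_ideal_prod_subset:
  assumes "\<And>J. J \<in> set Js \<Longrightarrow> ideal J R" "J \<in> set Js"
  shows "foldr (ideal_prod R) Js (carrier R) \<subseteq> J"
  using assms
proof (induction Js)
  case (Cons K Js)
  have "foldr (ideal_prod R) (K # Js) (carrier R) \<subseteq> K \<inter> foldr (ideal_prod R) Js (carrier R)"
    using ideal_prod_inter[of K "foldr (ideal_prod R) Js (carrier R)"]
      ideal_foldr_ideal_prod[of Js] Cons.prems(1) by simp
  then show ?case
    using Cons by auto
qed simp

section \<open>n-OA ideals when two nonunits add up to one\<close>

text \<open>
  If the last factor \<open>a\<^sub>n\<^sub>+\<^sub>1\<close> is not in \<open>I\<close>, then placing any nonunit \<open>e\<close> just before it and using the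
  (n+1)-OA property shows that \<open>e\<close> times the product of the other factors is in \<open>I\<close>. Taking
  \<open>e = c\<close> and \<open>e = d\<close> and adding gives that product itself.
\<close>
lemma (in cring) n_OA_ideal_pred:
  assumes c: "c \<in> carrier R - Units R" and d: "d \<in> carrier R - Units R" and cd: "c \<oplus> d = \<one>"
    and I: "n_OA_ideal (Suc n) I R"
  shows "n_OA_ideal n I R"
proof -
  from I interpret I: ideal I R
    by (simp add: n_OA_ideal_def)
  have "(\<Otimes>i\<in>{1..n}. a i) \<in> I \<or> a (n + 1) \<in> I"
    if a: "\<forall>i\<in>{1..n+1}. a i \<in> carrier R - Units R" and prod: "(\<Otimes>i\<in>{1..n+1}. a i) \<in> I" for a
  proof (cases "a (n + 1) \<in> I")
    case False
    let ?p = "\<Otimes>i\<in>{1..n}. a i"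
    have p: "?p \<in> carrier R"
      using a by (intro finprod_closed) auto
    have last: "a (n + 1) \<in> carrier R"
      using a by auto
    have "(\<Otimes>i\<in>insert (n + 1) {1..n}. a i) = a (n + 1) \<otimes> ?p"
      using a by (subst finprod_insert) auto
    moreover have "insert (n + 1) {1..n} = {1..n+1}"
      by auto
    ultimately have prod': "a (n + 1) \<otimes> ?p \<in> I"
      using prod by simp
    have *: "e \<otimes> ?p \<in> I" if e: "e \<in> carrier R - Units R" for e
    proof -
      define a' where "a' = a(n + 1 := e, n + 2 := a (n + 1))"
      have nonunits: "\<forall>i\<in>{1..Suc n+1}. a' i \<in> carrier R - Units R"
        using a e unfolding a'_def by auto
      have a'_last: "a' (n + 1) = e" "a' (n + 2) = a (n + 1)"
        by (auto simp: a'_def)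
      have ivl: "{1..Suc n} = insert (n + 1) {1..n}" "{1..Suc n+1} = insert (n + 2) {1..Suc n}"
        by auto
      have "(\<Otimes>i\<in>{1..n}. a' i) = ?p"
        using a by (intro finprod_cong') (auto simp: a'_def)
      moreover have "(\<Otimes>i\<in>{1..Suc n}. a' i) = a' (n + 1) \<otimes> (\<Otimes>i\<in>{1..n}. a' i)"
        unfolding ivl using nonunits by (subst finprod_insert) auto
      ultimately have init: "(\<Otimes>i\<in>{1..Suc n}. a' i) = e \<otimes> ?p"
        by (simp only: a'_last)
      have "(\<Otimes>i\<in>{1..Suc n+1}. a' i) = a' (n + 2) \<otimes> (\<Otimes>i\<in>{1..Suc n}. a' i)"
        unfolding ivl(2) using nonunits by (subst finprod_insert) auto
      also have "\<dots> = a (n + 1) \<otimes> (e \<otimes> ?p)"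
        by (simp only: init a'_last)
      also have "\<dots> = e \<otimes> (a (n + 1) \<otimes> ?p)"
        using e p last by (simp add: m_lcomm)
      also have "\<dots> \<in> I"
        using e by (intro I.I_l_closed[OF prod']) auto
      finally have "(\<Otimes>i\<in>{1..Suc n}. a' i) \<in> I \<or> a' (Suc n + 1) \<in> I"
        using I nonunits unfolding n_OA_ideal_def by blast
      then show ?thesis
        using False by (simp only: init) (simp add: a'_def)
    qed
    have "c \<otimes> ?p \<oplus> d \<otimes> ?p \<in> I"
      by (intro I.a_closed * c d)
    moreover have "c \<otimes> ?p \<oplus> d \<otimes> ?p = ?p"
      using c d p cd by (simp add: l_distr[symmetric])
    ultimately show ?thesis
      by simp
  qed simp
  then show ?thesis
    using I unfolding n_OA_ideal_def by blast
qed

lemma (in cring) n_OA_ideal_imp_primeideal: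
  assumes c: "c \<in> carrier R - Units R" and d: "d \<in> carrier R - Units R" and cd: "c \<oplus> d = \<one>"
    and "n \<ge> 1" "n_OA_ideal n I R"
  shows "primeideal I R"
proof -
  have I: "n_OA_ideal 1 I R"
    using \<open>n \<ge> 1\<close> \<open>n_OA_ideal n I R\<close>
    by (induction n rule: dec_induct) (auto dest: n_OA_ideal_pred[OF c d cd])
  then interpret I: ideal I R
    by (simp add: n_OA_ideal_def)
  have cancel: "b \<in> I" if "a \<in> Units R" "b \<in> carrier R" "a \<otimes> b \<in> I" for a b
  proof -
    have "inv a \<otimes> (a \<otimes> b) \<in> I"
      using that(1) by (intro I.I_l_closed[OF that(3)]) auto
    then show ?thesis
      using that by (metis Units_closed Units_inv_closed Units_l_inv l_one m_assoc)
  qed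
  show ?thesis
  proof (rule primeidealI)
    show "carrier R \<noteq> I"
      using I by (auto simp: n_OA_ideal_def)
  next
    fix a b assume a: "a \<in> carrier R" and b: "b \<in> carrier R" and ab: "a \<otimes> b \<in> I"
    show "a \<in> I \<or> b \<in> I"
    proof (cases "a \<in> Units R \<or> b \<in> Units R")
      case True
      then show ?thesis
        using cancel[of a b] cancel[of b a] a b ab by (auto simp: m_comm)
    next
      case False
      let ?s = "\<lambda>i. if i = 1 then a else b"
      have "{1..1 + 1::nat} = {1, 2}"
        by auto
      then have "(\<Otimes>i\<in>{1..1 + 1::nat}. ?s i) = a \<otimes> b"
        using a b by (simp add: Pi_def)
      moreover have "(\<Otimes>i\<in>{1..1::nat}. ?s i) = a"
        using a by (simp add: Pi_def)
      moreover have "\<forall>i\<in>{1..1 + 1::nat}. ?s i \<in> carrier R - Units R"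
        using False a b by auto
      ultimately show ?thesis
        using I[unfolded n_OA_ideal_def] ab by (smt (verit) add_eq_self_zero zero_neq_one)
    qed
  qed (rule I.is_ideal, rule is_cring)
qed

lemma (in cring) n_OAF_ring_imp_general_ZPI_ring:
  assumes "c \<in> carrier R - Units R" "d \<in> carrier R - Units R" "c \<oplus> d = \<one>"
    and "n \<ge> 1" "n_OAF_ring n R"
  shows "general_ZPI_ring R"
  unfolding general_ZPI_ring_def
proof (intro allI impI)
  fix I assume "ideal I R \<and> I \<noteq> carrier R"
  then obtain Js where "\<forall>J\<in>set Js. n_OA_ideal n J R" "I = foldr (ideal_prod R) Js (carrier R)"
    using \<open>n_OAF_ring n R\<close> unfolding n_OAF_ring_def by blast
  then show "\<exists>Ps. (\<forall>P\<in>set Ps. primeideal P R) \<and> I = foldr (ideal_prod R) Ps (carrier R)"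
    using n_OA_ideal_imp_primeideal[OF assms(1-4)] by blast
qed

section \<open>Rings with finitely many maximal ideals meeting in zero\<close>

text \<open>
  Distinct maximal ideals are comaximal, so the Chinese remainder theorem applies once repetitions
  are removed from the list; the list is nonempty because \<open>1\<close> would otherwise lie in every member.
\<close>
lemma (in cring) finite_product_of_fields_if_maximal_ideals_meet_in_zero:
  assumes max: "\<And>p. p \<in> set ps \<Longrightarrow> maximalideal p R"
    and zero: "\<And>a. a \<in> carrier R \<Longrightarrow> (\<And>p. p \<in> set ps \<Longrightarrow> a \<in> p) \<Longrightarrow> a = \<zero>"
    and "\<one> \<noteq> \<zero>"
  shows "finite_product_of_fields R"
proof -
  define qs where "qs = remdups ps"
  have qs: "set qs = set ps" "distinct qs"
    by (simp_all add: qs_def)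
  have "qs \<noteq> []"
    using zero[of \<one>] \<open>\<one> \<noteq> \<zero>\<close> by (auto simp: qs_def)
  then obtain n where n: "length qs = Suc n"
    by (cases qs) auto
  have maxq: "maximalideal (qs ! i) R" if "i \<le> n" for i
    using that n qs max by (metis le_imp_less_Suc nth_mem)
  have idq: "ideal (qs ! i) R" if "i \<le> n" for i
    using maxq[OF that] by (rule maximalideal.axioms(1))
  have comax: "qs ! i <+>\<^bsub>R\<^esub> qs ! j = carrier R" if ij: "i \<le> n" "j \<le> n" "i \<noteq> j" for i j
  proof -
    interpret p: maximalideal "qs ! i" R using maxq ij by blast
    interpret q: maximalideal "qs ! j" R using maxq ij by blast
    have neq: "qs ! i \<noteq> qs ! j"
      using ij n qs by (simp add: nth_eq_iff_index_eq)
    let ?s = "qs ! i <+>\<^bsub>R\<^esub> qs ! j"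
    have s: "ideal ?s R"
      by (intro add_ideals p.is_ideal q.is_ideal)
    have mem: "x \<oplus> y \<in> ?s" if "x \<in> qs ! i" "y \<in> qs ! j" for x y
      using that unfolding set_add_def' by blast
    have "x \<in> ?s" if "x \<in> qs ! i" for x
      using mem[OF that q.zero_closed] p.Icarr[OF that] by simp
    moreover have "x \<in> ?s" if "x \<in> qs ! j" for x
      using mem[OF p.zero_closed that] q.Icarr[OF that] by simp
    moreover have "?s \<subseteq> carrier R"
      using ideal.Icarr[OF s] by blast
    ultimately have "?s = qs ! i \<or> ?s = carrier R" "?s = qs ! j \<or> ?s = carrier R"
      using p.I_maximal[OF s] q.I_maximal[OF s] by blast+
    then show ?thesis
      using neq by auto
  qed
  have "(\<Inter>i\<le>n. qs ! i) = {\<zero>}"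
  proof (intro equalityI subsetI)
    fix a assume a: "a \<in> (\<Inter>i\<le>n. qs ! i)"
    then have "a \<in> carrier R"
      using ideal.Icarr[OF idq[of 0]] by auto
    moreover have "a \<in> p" if "p \<in> set ps" for p
      using that a n unfolding qs(1)[symmetric] in_set_conv_nth by (auto simp: less_Suc_eq_le)
    ultimately show "a \<in> {\<zero>}"
      using zero by blast
  next
    fix a assume "a \<in> {\<zero>}"
    then show "a \<in> (\<Inter>i\<le>n. qs ! i)"
      using additive_subgroup.zero_closed[OF ideal.axioms(1)[OF idq]] by auto
  qed
  then have "R Quot {\<zero>} \<simeq> RDirProd_list (map (\<lambda>i. R Quot (qs ! i)) [0..< Suc n])"
    using chinese_remainder[of n "\<lambda>i. qs ! i"] idq comax by simp
  then have "R \<simeq> RDirProd_list (map (\<lambda>i. R Quot (qs ! i)) [0..< Suc n])"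
    using ring_iso_trans FactRing_zeroideal(2) by blast
  moreover have "field F" if "F \<in> set (map (\<lambda>i. R Quot (qs ! i)) [0..< Suc n])" for F
    using that maximalideal.quotient_is_field[OF maxq is_cring] by (auto simp: less_Suc_eq_le)
  ultimately show ?thesis
    unfolding finite_product_of_fields_def by blast
qed

text \<open>
  From \<open>a = a\<^sup>2 b\<close> one gets \<open>a (1 - a b) = 0\<close>, so outside a prime ideal \<open>p\<close> every element is
  invertible modulo \<open>p\<close>.
\<close>
lemma (in cring) maximalideal_if_primeideal_von_Neumann_regular:
  assumes regular: "\<And>a. a \<in> carrier R \<Longrightarrow> \<exists>b\<in>carrier R. a = (a \<otimes> a) \<otimes> b"
    and "primeideal p R"
  shows "maximalideal p R"
proof -
  interpret p: primeideal p R by fact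
  show ?thesis
  proof (rule maximalidealI)
    fix J assume J: "ideal J R" "p \<subseteq> J" "J \<subseteq> carrier R"
    interpret J: ideal J R by fact
    have "J = carrier R" if a: "a \<in> J" "a \<notin> p" for a
    proof -
      have ac: "a \<in> carrier R" using a by (simp add: J.Icarr)
      obtain b where b: "b \<in> carrier R" "a = (a \<otimes> a) \<otimes> b"
        using regular[OF ac] by blast
      have "a \<otimes> (\<one> \<ominus> a \<otimes> b) = a \<ominus> (a \<otimes> a) \<otimes> b"
        using ac b(1) by algebra
      also have "\<dots> = \<zero>"
        using b ac by (metis a_minus_def r_neg)
      finally have "a \<otimes> (\<one> \<ominus> a \<otimes> b) \<in> p"
        by simp
      then have "\<one> \<ominus> a \<otimes> b \<in> J"
        using p.I_prime[of a "\<one> \<ominus> a \<otimes> b"] a ac b(1) J(2) by auto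
      moreover have "a \<otimes> b \<in> J"
        using a b(1) by (intro J.I_r_closed)
      ultimately have "(\<one> \<ominus> a \<otimes> b) \<oplus> a \<otimes> b \<in> J"
        by (rule J.a_closed)
      moreover have "(\<one> \<ominus> a \<otimes> b) \<oplus> a \<otimes> b = \<one>"
        using ac b(1) by algebra
      ultimately show ?thesis
        using J.one_imp_carrier by simp
    qed
    then show "J = p \<or> J = carrier R"
      using J(2) by blast
  qed (rule p.is_ideal, rule p.I_notcarr)
qed

section \<open>Polynomial rings that are general ZPI-rings\<close>

lemma (in UP_cring) coeff_mult_0:
  assumes "p \<in> carrier P" "q \<in> carrier P"
  shows "coeff P (p \<otimes>\<^bsub>P\<^esub> q) 0 = coeff P p 0 \<otimes> coeff P q 0"
  using assms by simp

lemma (in UP_cring) coeff_mult_1: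
  assumes "p \<in> carrier P" "q \<in> carrier P"
  shows "coeff P (p \<otimes>\<^bsub>P\<^esub> q) (Suc 0) =
    coeff P p 0 \<otimes> coeff P q (Suc 0) \<oplus> coeff P p (Suc 0) \<otimes> coeff P q 0"
  using assms by (simp add: R.a_comm)

lemmas (in UP_cring) coeff_mult_01 = coeff_mult_0 coeff_mult_1

context UP_cring
begin

text \<open>
  The linear coefficient behaves like a derivation, and this is an induction on the number of
  factors along the Leibniz rule:
  \<open>a (p q)\<^sub>1 = p\<^sub>0 (a q\<^sub>1) + (a p\<^sub>1) q\<^sub>0\<close>. The first conclusion is carried along because the
  constants \<open>p\<^sub>0\<close> and \<open>q\<^sub>0\<close> must again lie in the respective ideals.
\<close>
lemma linear_coeff_mult_mem_foldr_ideal_prod: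
  assumes ideals: "\<And>J. J \<in> set Js \<Longrightarrow> ideal J P"
    and X_sub: "\<And>J. J \<in> set Js \<Longrightarrow> {f \<in> carrier P. coeff P f 0 = \<zero>} \<subseteq> J"
    and a: "a \<in> carrier R" "\<And>J. J \<in> set Js \<Longrightarrow> monom P a 0 \<in> J"
    and f: "f \<in> foldr (ideal_prod P) Js (carrier P)"
  shows "monom P (coeff P f 0) 0 \<in> foldr (ideal_prod P) Js (carrier P)"
    and "monom P (a \<otimes> coeff P f (Suc 0)) 0 \<in> foldr (ideal_prod P) Js (carrier P)"
proof -
  let ?K = "\<lambda>Js. foldr (ideal_prod P) Js (carrier P)"
  have "monom P (coeff P f 0) 0 \<in> ?K Js \<and> monom P (a \<otimes> coeff P f (Suc 0)) 0 \<in> ?K Js"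
    using ideals X_sub a(2) f
  proof (induction Js arbitrary: f)
    case Nil
    then show ?case using a(1) by simp
  next
    case (Cons J Js)
    interpret J: ideal J P using Cons.prems(1) by simp
    interpret K: ideal "?K Js" P
      using Cons.prems(1) by (intro P.ideal_foldr_ideal_prod) auto
    have IH: "monom P (coeff P q 0) 0 \<in> ?K Js" "monom P (a \<otimes> coeff P q (Suc 0)) 0 \<in> ?K Js"
      if "q \<in> ?K Js" for q
      using Cons.IH[of q] Cons.prems that by auto
    have J0: "monom P (coeff P p 0) 0 \<in> J" if p: "p \<in> J" for p
    proof -
      have pc: "p \<in> carrier P" using p by (rule J.Icarr)
      have "monom P (coeff P p 0) 0 \<ominus>\<^bsub>P\<^esub> p \<in> J"
        using pc by (intro subsetD[OF Cons.prems(2)[of J]]) (auto simp: a_minus_def R.r_neg)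
      then have "(monom P (coeff P p 0) 0 \<ominus>\<^bsub>P\<^esub> p) \<oplus>\<^bsub>P\<^esub> p \<in> J"
        using p by (rule J.a_closed)
      moreover have "(monom P (coeff P p 0) 0 \<ominus>\<^bsub>P\<^esub> p) \<oplus>\<^bsub>P\<^esub> p = monom P (coeff P p 0) 0"
        using pc by (simp add: a_minus_def P.a_assoc P.l_neg)
      ultimately show ?thesis by simp
    qed
    have mm: "monom P (x \<otimes> y) 0 = monom P x 0 \<otimes>\<^bsub>P\<^esub> monom P y 0"
      if "x \<in> carrier R" "y \<in> carrier R" for x y
      using monom_mult[OF that, of 0 0] by simp
    have "f \<in> J \<cdot>\<^bsub>P\<^esub> ?K Js"
      using Cons.prems(4) by simp
    then have "monom P (coeff P f 0) 0 \<in> J \<cdot>\<^bsub>P\<^esub> ?K Js \<and>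
      monom P (a \<otimes> coeff P f (Suc 0)) 0 \<in> J \<cdot>\<^bsub>P\<^esub> ?K Js \<and> f \<in> carrier P"
    proof (induction rule: ideal_prod.induct)
      case (prod p q)
      have c: "p \<in> carrier P" "q \<in> carrier P"
        using prod J.Icarr K.Icarr by auto
      have "monom P (coeff P (p \<otimes>\<^bsub>P\<^esub> q) 0) 0 \<in> J \<cdot>\<^bsub>P\<^esub> ?K Js"
        using c prod J0 IH by (simp add: coeff_mult_0 mm ideal_prod.prod del: coeff_mult monom_mult)
      moreover have "monom P (a \<otimes> coeff P (p \<otimes>\<^bsub>P\<^esub> q) (Suc 0)) 0 \<in> J \<cdot>\<^bsub>P\<^esub> ?K Js"
      proof -
        have "a \<otimes> coeff P (p \<otimes>\<^bsub>P\<^esub> q) (Suc 0) =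
            coeff P p 0 \<otimes> (a \<otimes> coeff P q (Suc 0)) \<oplus> (a \<otimes> coeff P p (Suc 0)) \<otimes> coeff P q 0"
          using c a(1) by (simp add: coeff_mult_1 R.r_distr R.m_lcomm R.m_assoc del: coeff_mult)
        then have eq: "monom P (a \<otimes> coeff P (p \<otimes>\<^bsub>P\<^esub> q) (Suc 0)) 0 =
            monom P (coeff P p 0) 0 \<otimes>\<^bsub>P\<^esub> monom P (a \<otimes> coeff P q (Suc 0)) 0 \<oplus>\<^bsub>P\<^esub>
            monom P (a \<otimes> coeff P p (Suc 0)) 0 \<otimes>\<^bsub>P\<^esub> monom P (coeff P q 0) 0"
          using c a(1) by (simp only: monom_add mm R.m_closed coeff_closed)
        have "monom P a 0 \<otimes>\<^bsub>P\<^esub> monom P (coeff P p (Suc 0)) 0 \<in> J"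
          using Cons.prems(3) c by (intro J.I_r_closed) auto
        then have "monom P (a \<otimes> coeff P p (Suc 0)) 0 \<in> J"
          using c a(1) by (simp only: mm coeff_closed)
        then show ?thesis
          unfolding eq using prod J0 IH by (intro ideal_prod.sum ideal_prod.prod) auto
      qed
      ultimately show ?case using c by simp
    next
      case (sum s t)
      then show ?case
        using a(1) by (simp add: R.r_distr ideal_prod.sum)
    qed
    then show ?case by simp
  qed
  then show "monom P (coeff P f 0) 0 \<in> ?K Js" "monom P (a \<otimes> coeff P f (Suc 0)) 0 \<in> ?K Js"
    by auto
qed

lemma const_coeff_ideal:
  assumes "ideal J R"
  shows "ideal {f \<in> carrier P. coeff P f 0 \<in> J} P"
proof -
  interpret J: ideal J R by fact
  show ?thesis
  proof (rule idealI)
    show "subgroup {f \<in> carrier P. coeff P f 0 \<in> J} (add_monoid P)"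
      by (rule P.add.subgroupI) (auto simp: a_inv_def[symmetric] intro: exI[of _ "\<zero>\<^bsub>P\<^esub>"])
  qed (auto simp: P.ring_axioms coeff_mult_0 J.I_l_closed J.I_r_closed simp del: coeff_mult)
qed

text \<open>
  The ideals \<open>Q\<close> come from a factorization of the ideal of polynomials with constant coefficient
  in \<open>J\<close>. This ideal contains \<open>X\<close>, whose linear coefficient is \<open>1\<close>, so by the Leibniz rule a
  constant lying in every factor lies in the product. Thus \<open>J\<close> is not merely a product but an
  intersection of finitely many primes.
\<close>
lemma const_coeff_ideal_factorization:
  assumes ZPI: "general_ZPI_ring P" and J: "ideal J R" "J \<noteq> carrier R"
  obtains Ps where "\<And>Q. Q \<in> set Ps \<Longrightarrow> primeideal Q P"
    and "\<And>a. a \<in> carrier R \<Longrightarrow> a \<in> J \<longleftrightarrow> (\<forall>Q\<in>set Ps. monom P a 0 \<in> Q)"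
proof -
  interpret J: ideal J R by fact
  let ?I = "{f \<in> carrier P. coeff P f 0 \<in> J}"
  have "\<one>\<^bsub>P\<^esub> \<notin> ?I"
    using J J.one_imp_carrier by auto
  then have "?I \<noteq> carrier P"
    by (metis P.one_closed)
  then obtain Ps where Ps: "\<And>Q. Q \<in> set Ps \<Longrightarrow> primeideal Q P"
    and I: "?I = foldr (ideal_prod P) Ps (carrier P)"
    using general_ZPI_ringE[OF ZPI const_coeff_ideal[OF J(1)]] by blast
  have ideals: "ideal Q P" if "Q \<in> set Ps" for Q
    using Ps[OF that] by (rule primeideal.axioms(1))
  have sub: "?I \<subseteq> Q" if "Q \<in> set Ps" for Q
    unfolding I using that ideals by (intro P.foldr_ideal_prod_subset)
  have X_sub: "{f \<in> carrier P. coeff P f 0 = \<zero>} \<subseteq> Q" if "Q \<in> set Ps" for Q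
    using sub[OF that] J.zero_closed by auto
  have mem_if: "a \<in> J" if a: "a \<in> carrier R" and Q: "\<forall>Q\<in>set Ps. monom P a 0 \<in> Q" for a
  proof -
    have "monom P \<one> (Suc 0) \<in> ?I"
      by simp
    then have "monom P (a \<otimes> coeff P (monom P \<one> (Suc 0)) (Suc 0)) 0 \<in> ?I"
      unfolding I using ideals X_sub a Q
      by (intro linear_coeff_mult_mem_foldr_ideal_prod(2)) blast+
    then show ?thesis
      using a by simp
  qed
  have mem_only_if: "\<forall>Q\<in>set Ps. monom P a 0 \<in> Q" if "a \<in> carrier R" "a \<in> J" for a
    using subsetD[OF sub, of _ "monom P a 0"] that by simp
  show ?thesis
    by (rule that[of Ps]) (use Ps mem_if mem_only_if in \<open>blast+\<close>)
qed

text \<open>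
  Principal ideals \<open>a\<^sup>2 R\<close> are radical, which makes \<open>R\<close> von Neumann regular, and the zero ideal is an
  intersection of finitely many primes, which are then maximal.
\<close>
lemma finite_product_of_fields_if_UP_general_ZPI:
  assumes ZPI: "general_ZPI_ring P" and "\<one> \<noteq> \<zero>"
  shows "finite_product_of_fields R"
proof -
  have regular: "\<exists>b\<in>carrier R. a = (a \<otimes> a) \<otimes> b" if a: "a \<in> carrier R" for a
  proof -
    let ?J = "PIdl (a \<otimes> a)"
    have J: "ideal ?J R"
      using a by (intro R.cgenideal_ideal) auto
    have "a \<in> ?J"
    proof (cases "?J = carrier R")
      case False
      obtain Ps where Ps: "\<And>Q. Q \<in> set Ps \<Longrightarrow> primeideal Q P"
        and mem: "\<And>a'. a' \<in> carrier R \<Longrightarrow> a' \<in> ?J \<longleftrightarrow> (\<forall>Q\<in>set Ps. monom P a' 0 \<in> Q)"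
        using const_coeff_ideal_factorization[OF ZPI J False] by blast
      have "a \<otimes> a \<in> ?J"
        using a by (intro R.cgenideal_self) auto
      then have "\<forall>Q\<in>set Ps. monom P a 0 \<otimes>\<^bsub>P\<^esub> monom P a 0 \<in> Q"
        using mem[of "a \<otimes> a"] a monom_mult[of a a 0 0] by simp
      then have "\<forall>Q\<in>set Ps. monom P a 0 \<in> Q"
        using primeideal.I_prime[OF Ps, of _ "monom P a 0" "monom P a 0"] a by auto
      then show ?thesis
        using mem a by blast
    qed (use a in simp)
    then obtain b where "b \<in> carrier R" "a = b \<otimes> (a \<otimes> a)"
      unfolding cgenideal_def by blast
    then show ?thesis
      using a by (metis R.m_closed R.m_comm)
  qed
  have "{\<zero>} \<noteq> carrier R"
    using \<open>\<one> \<noteq> \<zero>\<close> R.one_closed by blast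
  then obtain Ps where Ps: "\<And>Q. Q \<in> set Ps \<Longrightarrow> primeideal Q P"
    and mem: "\<And>a. a \<in> carrier R \<Longrightarrow> a \<in> {\<zero>} \<longleftrightarrow> (\<forall>Q\<in>set Ps. monom P a 0 \<in> Q)"
    using const_coeff_ideal_factorization[OF ZPI R.zeroideal] by blast
  interpret const: ring_hom_ring R P "\<lambda>a. monom P a 0"
    by (rule ring_hom_ringI2) (auto simp: R.ring_axioms P.ring_axioms const_ring_hom)
  let ?ps = "map (\<lambda>Q. {a \<in> carrier R. monom P a 0 \<in> Q}) Ps"
  have max: "maximalideal p R" if "p \<in> set ?ps" for p
  proof -
    have "primeideal p R"
      using that Ps const.primeideal_vimage[OF R.is_cring] by auto
    with regular show ?thesis
      by (rule R.maximalideal_if_primeideal_von_Neumann_regular)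
  qed
  have meet: "a = \<zero>" if "a \<in> carrier R" "\<And>p. p \<in> set ?ps \<Longrightarrow> a \<in> p" for a
    using mem[OF that(1)] that(2) by auto
  show ?thesis
    by (rule R.finite_product_of_fields_if_maximal_ideals_meet_in_zero[OF max meet \<open>\<one> \<noteq> \<zero>\<close>])
qed

end

section \<open>The ring \<open>A + X B[X]\<close>\<close>

locale const_in_poly = UP_cring R P for R (structure) and P (structure) +
  fixes A S
  defines S_def: "S \<equiv> const_in_poly_ring A R"
  assumes subring: "subring A R"
    and nontrivial: "\<one> \<noteq> \<zero>"
begin

lemma A_closed:
  "\<zero> \<in> A" "\<one> \<in> A"
  "x \<in> A \<Longrightarrow> \<ominus> x \<in> A"
  "x \<in> A \<Longrightarrow> y \<in> A \<Longrightarrow> x \<oplus> y \<in> A"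
  "x \<in> A \<Longrightarrow> y \<in> A \<Longrightarrow> x \<otimes> y \<in> A"
  "x \<in> A \<Longrightarrow> x \<in> carrier R"
  using subringE[OF subring] by auto

lemma S_simps:
  "carrier S = {f \<in> carrier P. coeff P f 0 \<in> A}"
  "mult S = mult P" "one S = one P" "add S = add P" "zero S = zero P"
  by (simp_all add: S_def const_in_poly_ring_def P_def)

lemma S_cring: "cring S"
proof -
  have "S = P\<lparr>carrier := carrier S\<rparr>"
    by (simp add: S_def const_in_poly_ring_def P_def)
  moreover have "subcring (carrier S) P"
    unfolding S_def P_def by (rule R.subcring_const_in_poly_ring[OF subring])
  ultimately show ?thesis
    using P.subcring_iff[of "carrier S"] by (auto simp: S_simps)
qed

sublocale S: cring S
  by (rule S_cring)

abbreviation X where "X \<equiv> monom P \<one> (Suc 0)"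

lemma X_nonunit: "X \<in> carrier S - Units S"
proof -
  have False if "g \<in> carrier S" "X \<otimes>\<^bsub>P\<^esub> g = \<one>\<^bsub>P\<^esub>" for g
    using that nontrivial coeff_mult_0[of X g] by (auto simp: S_simps)
  then show ?thesis
    using A_closed by (auto simp: Units_def S_simps)
qed

text \<open>It vanishes at \<open>1\<close>, whereas units evaluate to units and \<open>1 \<noteq> 0\<close>.\<close>
lemma one_minus_X_nonunit: "\<one>\<^bsub>P\<^esub> \<ominus>\<^bsub>P\<^esub> X \<in> carrier S - Units S"
proof -
  let ?ev = "eval R R id \<one>"
  interpret UP_pre_univ_prop R R id by unfold_locales simp
  interpret ev: ring_hom_cring P R ?ev
    by unfold_locales (use eval_ring_hom[OF R.one_closed] in simp)
  have "?ev X = \<one>"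
    using eval_monom[OF R.one_closed R.one_closed, of "Suc 0"] by simp
  then have zero: "?ev (\<one>\<^bsub>P\<^esub> \<ominus>\<^bsub>P\<^esub> X) = \<zero>"
    by (simp add: a_minus_def R.r_neg)
  have False if g: "g \<in> carrier S" "(\<one>\<^bsub>P\<^esub> \<ominus>\<^bsub>P\<^esub> X) \<otimes>\<^bsub>P\<^esub> g = \<one>\<^bsub>P\<^esub>" for g
  proof -
    have gP: "g \<in> carrier P"
      using g by (simp add: S_simps)
    have "\<one> = ?ev ((\<one>\<^bsub>P\<^esub> \<ominus>\<^bsub>P\<^esub> X) \<otimes>\<^bsub>P\<^esub> g)"
      unfolding g(2) by simp
    also have "\<dots> = ?ev (\<one>\<^bsub>P\<^esub> \<ominus>\<^bsub>P\<^esub> X) \<otimes> ?ev g"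
      using gP by (intro ev.hom_mult) (auto simp: a_minus_def)
    also have "\<dots> = \<zero>"
      unfolding zero using gP by simp
    finally show False
      using nontrivial by simp
  qed
  then show ?thesis
    using A_closed by (auto simp: Units_def S_simps a_minus_def)
qed

lemma n_OAF_ring_imp_general_ZPI_ring:
  assumes "n \<ge> 1" "n_OAF_ring n S"
  shows "general_ZPI_ring S"
proof (rule S.n_OAF_ring_imp_general_ZPI_ring[OF X_nonunit one_minus_X_nonunit _ assms])
  have "X \<oplus>\<^bsub>P\<^esub> (\<one>\<^bsub>P\<^esub> \<ominus>\<^bsub>P\<^esub> X) = \<one>\<^bsub>P\<^esub>"
    by (simp add: a_minus_def P.a_lcomm P.r_neg)
  then show "X \<oplus>\<^bsub>S\<^esub> (\<one>\<^bsub>P\<^esub> \<ominus>\<^bsub>P\<^esub> X) = \<one>\<^bsub>S\<^esub>"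
    by (simp add: S_simps)
qed

text \<open>
  A single factor has the closure property because it contains \<open>(b - 1) p\<^sub>1 X\<close>, which can be added
  to \<open>p\<close>. The property passes to products since \<open>b (p q)\<^sub>1 = p\<^sub>0 (b q\<^sub>1) + (b p\<^sub>1) q\<^sub>0\<close>. The scalar \<open>b\<close>
  need not be in \<open>A\<close>, so this is more than closure under multiplication by elements of \<open>S\<close>.
\<close>
lemma rescale_foldr_ideal_prod:
  assumes ideals: "\<And>J. J \<in> set Js \<Longrightarrow> ideal J S"
    and X_sub: "\<And>J. J \<in> set Js \<Longrightarrow> {f \<in> carrier P. coeff P f 0 = \<zero>} \<subseteq> J"
    and b: "b \<in> carrier R"
    and f: "f \<in> foldr (ideal_prod S) Js (carrier S)"
  shows "\<exists>g \<in> foldr (ideal_prod S) Js (carrier S).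
    coeff P g 0 = coeff P f 0 \<and> coeff P g (Suc 0) = b \<otimes> coeff P f (Suc 0)"
  using ideals X_sub f
proof (induction Js arbitrary: f)
  case Nil
  then show ?case
    using b by (intro bexI[of _ "monom P (coeff P f 0) 0 \<oplus>\<^bsub>P\<^esub> monom P (b \<otimes> coeff P f (Suc 0)) (Suc 0)"])
      (auto simp: S_simps)
next
  case (Cons J Js)
  let ?K = "foldr (ideal_prod S) Js (carrier S)"
  interpret J: ideal J S using Cons.prems(1) by simp
  interpret K: ideal ?K S
    using Cons.prems(1) by (intro S.ideal_foldr_ideal_prod) auto
  have JP: "p \<in> carrier P" if "p \<in> J" for p
    using J.Icarr[OF that] by (simp add: S_simps)
  have KP: "p \<in> carrier P" if "p \<in> ?K" for p
    using K.Icarr[OF that] by (simp add: S_simps)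
  have JK: "p \<in> carrier P" if "p \<in> J \<cdot>\<^bsub>S\<^esub> ?K" for p
    using S.ideal_prod_in_carrier[OF J.is_ideal K.is_ideal] that by (auto simp: S_simps)
  have rescale_J: "\<exists>g\<in>J. coeff P g 0 = coeff P p 0 \<and> coeff P g (Suc 0) = b \<otimes> coeff P p (Suc 0)"
    if p: "p \<in> J" for p
  proof -
    define d where "d = monom P (b \<otimes> coeff P p (Suc 0) \<ominus> coeff P p (Suc 0)) (Suc 0)"
    have "d \<in> J"
      using JP[OF p] b by (intro subsetD[OF Cons.prems(2)[of J]]) (auto simp: d_def simp del: monom_add)
    then have "p \<oplus>\<^bsub>S\<^esub> d \<in> J"
      using p by (intro J.a_closed)
    moreover have "coeff P (p \<oplus>\<^bsub>P\<^esub> d) 0 = coeff P p 0"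
      using JP[OF p] b by (simp add: d_def del: monom_add)
    moreover have "coeff P (p \<oplus>\<^bsub>P\<^esub> d) (Suc 0) = b \<otimes> coeff P p (Suc 0)"
    proof -
      have "x \<oplus> (b \<otimes> x \<ominus> x) = b \<otimes> x" if "x \<in> carrier R" for x
        using that b by algebra
      then show ?thesis
        using JP[OF p] b by (simp add: d_def del: monom_add)
    qed
    ultimately show ?thesis
      by (auto simp: S_simps)
  qed
  have "f \<in> J \<cdot>\<^bsub>S\<^esub> ?K"
    using Cons.prems(3) by simp
  then have "\<exists>g \<in> J \<cdot>\<^bsub>S\<^esub> ?K. coeff P g 0 = coeff P f 0 \<and> coeff P g (Suc 0) = b \<otimes> coeff P f (Suc 0)"
  proof (induction rule: ideal_prod.induct)
    case (prod p q)
    obtain p' where p': "p' \<in> J" "coeff P p' 0 = coeff P p 0"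
        "coeff P p' (Suc 0) = b \<otimes> coeff P p (Suc 0)"
      using rescale_J prod by blast
    obtain q' where q': "q' \<in> ?K" "coeff P q' 0 = coeff P q 0"
        "coeff P q' (Suc 0) = b \<otimes> coeff P q (Suc 0)"
      using Cons.IH[of q] Cons.prems prod by auto
    have "p' \<otimes>\<^bsub>S\<^esub> q' \<in> J \<cdot>\<^bsub>S\<^esub> ?K"
      using p' q' by (intro ideal_prod.prod)
    moreover have c: "p \<in> carrier P" "q \<in> carrier P" "p' \<in> carrier P" "q' \<in> carrier P"
      using prod p' q' JP KP by auto
    then have "coeff P (p' \<otimes>\<^bsub>P\<^esub> q') 0 = coeff P (p \<otimes>\<^bsub>P\<^esub> q) 0"
      using p' q' by (simp add: coeff_mult_0 del: coeff_mult)
    moreover have "coeff P (p' \<otimes>\<^bsub>P\<^esub> q') (Suc 0) = b \<otimes> coeff P (p \<otimes>\<^bsub>P\<^esub> q) (Suc 0)"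
      using c p' q' b
      by (simp add: coeff_mult_1 R.r_distr R.m_lcomm R.m_assoc del: coeff_mult)
    ultimately show ?case
      by (auto simp: S_simps)
  next
    case (sum s t)
    then obtain s' t' where st': "s' \<in> J \<cdot>\<^bsub>S\<^esub> ?K" "coeff P s' 0 = coeff P s 0"
        "coeff P s' (Suc 0) = b \<otimes> coeff P s (Suc 0)"
        "t' \<in> J \<cdot>\<^bsub>S\<^esub> ?K" "coeff P t' 0 = coeff P t 0"
        "coeff P t' (Suc 0) = b \<otimes> coeff P t (Suc 0)"
      by blast
    show ?case
    proof (intro bexI conjI)
      show "s' \<oplus>\<^bsub>S\<^esub> t' \<in> J \<cdot>\<^bsub>S\<^esub> ?K"
        using st' by (intro ideal_prod.sum)
    qed (use sum.hyps st' b JK in \<open>simp_all add: S_simps R.r_distr\<close>)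
  qed
  then show ?case by simp
qed

text \<open>
  The linear coefficients of the ideal \<open>?I\<close> below form exactly \<open>A\<close>, but as a product of primes
  containing \<open>X B[X]\<close> its linear coefficients are closed under multiplication by all of \<open>B\<close>.
\<close>
lemma general_ZPI_ring_imp_eq_carrier:
  assumes "general_ZPI_ring S"
  shows "A = carrier R"
proof -
  let ?I = "{f \<in> carrier P. coeff P f 0 = \<zero> \<and> coeff P f (Suc 0) \<in> A}"
  have "ideal ?I S"
  proof (rule idealI)
    show "subgroup ?I (add_monoid S)"
    proof (rule S.add.subgroupI)
      fix f assume f: "f \<in> ?I"
      have "\<ominus>\<^bsub>S\<^esub> f = \<ominus>\<^bsub>P\<^esub> f"
        using f A_closed by (intro S.minus_equality) (auto simp: S_simps P.l_neg)
      then show "\<ominus>\<^bsub>S\<^esub> f \<in> ?I"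
        using f A_closed by simp
    qed (use A_closed in \<open>auto simp: S_simps intro: exI[of _ "\<zero>\<^bsub>P\<^esub>"]\<close>)
  qed (use A_closed in \<open>auto simp: S.ring_axioms S_simps coeff_mult_01 simp del: coeff_mult\<close>)
  moreover have "\<one>\<^bsub>P\<^esub> \<notin> ?I"
    using nontrivial by simp
  then have "?I \<noteq> carrier S"
    using S.one_closed by (metis S_simps(3))
  ultimately obtain Ps where Ps: "\<And>Q. Q \<in> set Ps \<Longrightarrow> primeideal Q S"
    and I: "?I = foldr (ideal_prod S) Ps (carrier S)"
    using general_ZPI_ringE[OF assms] by blast
  have ideals: "ideal Q S" if "Q \<in> set Ps" for Q
    using Ps[OF that] by (rule primeideal.axioms(1))
  have X_sub: "{f \<in> carrier P. coeff P f 0 = \<zero>} \<subseteq> Q" if Q: "Q \<in> set Ps" for Q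
  proof
    fix f assume "f \<in> {f \<in> carrier P. coeff P f 0 = \<zero>}"
    then have f: "f \<in> carrier P" "coeff P f 0 = \<zero>"
      by auto
    \<comment> \<open>The square has no linear coefficient, although that of \<open>f\<close> may lie outside \<open>A\<close>.\<close>
    have "f \<otimes>\<^bsub>S\<^esub> f \<in> ?I"
      using f A_closed by (simp add: S_simps coeff_mult_01 del: coeff_mult)
    then have "f \<otimes>\<^bsub>S\<^esub> f \<in> Q"
      using S.foldr_ideal_prod_subset[of Ps Q] ideals Q unfolding I by blast
    then show "f \<in> Q"
      using primeideal.I_prime[OF Ps[OF Q], of f f] f A_closed by (auto simp: S_simps)
  qed
  have "b \<in> A" if b: "b \<in> carrier R" for b
  proof -
    have "X \<in> ?I"
      using A_closed by simp
    then obtain g where "g \<in> ?I" "coeff P g (Suc 0) = b \<otimes> coeff P X (Suc 0)"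
      using rescale_foldr_ideal_prod[of Ps b X] ideals X_sub b unfolding I by blast
    then show ?thesis
      using b by simp
  qed
  then show ?thesis
    using A_closed(6) by blast
qed

end

theorem proposition3p5:
  fixes n :: nat
    and B :: "('a, 'm) ring_scheme"
    and A :: "'a set"
  assumes "n \<ge> 1"
    and "cring B"
    and "\<one>\<^bsub>B\<^esub> \<noteq> \<zero>\<^bsub>B\<^esub>"
    and "subring A B"
    and "n_OAF_ring n (const_in_poly_ring A B)"
  shows "finite_product_of_fields (B\<lparr>carrier := A\<rparr>)"
proof -
  interpret B: cring B by fact
  interpret const_in_poly B "UP B" A "const_in_poly_ring A B"
    using assms by (intro const_in_poly.intro const_in_poly_axioms.intro UP_cring.intro) auto
  have ZPI: "general_ZPI_ring (const_in_poly_ring A B)"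
    using assms by (intro n_OAF_ring_imp_general_ZPI_ring)
  then have A: "A = carrier B"
    by (rule general_ZPI_ring_imp_eq_carrier)
  then have "{p \<in> carrier (UP B). coeff (UP B) p 0 \<in> A} = carrier (UP B)"
    by auto
  then have "const_in_poly_ring A B = UP B"
    unfolding const_in_poly_ring_def by simp
  then have "finite_product_of_fields B"
    using ZPI assms(3) by (intro finite_product_of_fields_if_UP_general_ZPI) simp_all
  then show ?thesis
    by (simp add: A)
qed

end
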